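(* Let $(Q,\cdot,\backslash,/)$ be a middle Bol loop with identity $e$ and let $f_1,g_1:Q^2\to Q$ be maps. 1. $f_1(x,y)=(yx)\backslash x$ for all $x,y$ if and only if $f_1(x,y)=x\backslash(y\backslash x)$ for all $x,y$. For this $f_1$ and all $x\in Q$: (a) $f_1(x,e)=e$; (b) $f_1(x^{-1},e)=e$; (c) $f_1(e,e)=e$; (d) $f_1(e,x)=x^{-1}$; (e) $f_1(x,x)=x^{-1}$; (f) $f_1(x^{-1},x)=x^{-1}$; (g) $f_1(e,x^{-1})=x$; (h) $f_1(x,x^{-1})=x$. 2. $g_1(x,y)=(xy)\backslash x$ for all $x,y$ if and only if $g_1(x,y)=x\backslash(x/y)$ for all $x,y$. For this $g_1$ and all $x\in Q$: (a) $g_1(x,e)=e$; (b) $g_1(x^{-1},e)=e$; (c) $g_1(e,e)=e$; (d) $g_1(e,x)=x^{-1}$; (e) $g_1(x,x)=x^{-1}$; (f) $g_1(x^{-1},x)=x^{-1}$; (g) $g_1(e,x^{-1})=x$; (h) $g_1(x,x^{-1})=x$. With $f_1$ and $g_1$ being these maps, and identities required for all $x,y\in Q$: 3. $f_1(x,y)=g_1(x,y)\Leftrightarrow (Q,\cdot)$ is commutative. 4. $f_1(x,y)=g_1(x,y)\Leftrightarrow (Q,(\backslash)^* )\equiv(Q,/)\Leftrightarrow (Q,\backslash)\equiv(Q,(/)^* )$. 5. $f_1(x,y)=g_1(x,y)\Leftrightarrow (yx)\backslash x=x\backslash(x/y)\Leftrightarrow (xy)\backslash x=x\backslash(y\backslash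 x)$. 6. $x=y\cdot(x/y)\Leftrightarrow (y\backslash x)\cdot y=x$.
   Context: A loop $(Q,\cdot,\backslash,/)$ is a loop $(Q,\cdot)$ with identity $e$, where $x\backslash y$ is the unique $z$ with $x\cdot z=y$ and $x/y$ is the unique $z$ with $z\cdot y=x$. It is a middle Bol loop if $x((yz)\backslash x)=(x/z)(y\backslash x)$ for all $x,y,z$. In a middle Bol loop left and right inverses coincide; $x^{-1}$ denotes the two-sided inverse. For a binary operation, the superscript $*$ denotes the opposite operation: $x(\backslash)^*y=y\backslash x$ and $x(/)^*y=y/x$. The notation $(Q,\circ)\equiv(Q,\bullet)$ means that the operations $\circ$ and $\bullet$ coincide. *)

theory Defs
  imports "HOL-Algebra.Group"
begin

locale loop =
  fixes Q (structure)
  assumes mult_closed: "\<lbrakk>x \<in> carrier Q; y \<in> carrier Q\<rbrakk> \<Longrightarrow> x \<otimes> y \<in> carrier Q"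
    and one_closed: "\<one> \<in> carrier Q"
    and left_one: "x \<in> carrier Q \<Longrightarrow> \<one> \<otimes> x = x"
    and right_one: "x \<in> carrier Q \<Longrightarrow> x \<otimes> \<one> = x"
    and left_division: "\<lbrakk>x \<in> carrier Q; y \<in> carrier Q\<rbrakk> \<Longrightarrow> \<exists>!z. z \<in> carrier Q \<and> x \<otimes> z = y"
    and right_division: "\<lbrakk>x \<in> carrier Q; y \<in> carrier Q\<rbrakk> \<Longrightarrow> \<exists>!z. z \<in> carrier Q \<and> z \<otimes> y = x"

text \<open>\<open>ldiv Q x y\<close> is $x \backslash y$ and \<open>rdiv Q x y\<close> is $x / y$.\<close>

definition ldiv :: "('a, 'b) monoid_scheme \<Rightarrow> 'a \<Rightarrow> 'a \<Rightarrow> 'a" where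
  "ldiv Q x y = (THE z. z \<in> carrier Q \<and> x \<otimes>\<^bsub>Q\<^esub> z = y)"

definition rdiv :: "('a, 'b) monoid_scheme \<Rightarrow> 'a \<Rightarrow> 'a \<Rightarrow> 'a" where
  "rdiv Q x y = (THE z. z \<in> carrier Q \<and> z \<otimes>\<^bsub>Q\<^esub> y = x)"

locale middle_bol_loop = loop +
  assumes middle_bol:
    "\<lbrakk>x \<in> carrier Q; y \<in> carrier Q; z \<in> carrier Q\<rbrakk> \<Longrightarrow>
      x \<otimes> ldiv Q (y \<otimes> z) x = rdiv Q x z \<otimes> ldiv Q y x"

text \<open>The two-sided inverse is the library's \<^const>\<open>m_inv\<close>, a definite description. It is
  meaningful here because the left and right inverses coincide, which is the case
  $x = y = e$ of the middle Bol identity.\<close>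

lemma (in loop) ldiv_props:
  assumes "x \<in> carrier Q" "y \<in> carrier Q"
  shows "ldiv Q x y \<in> carrier Q" "x \<otimes> ldiv Q x y = y"
  using theI'[OF left_division[OF assms]] by (simp_all add: ldiv_def)

lemma (in loop) rdiv_props:
  assumes "x \<in> carrier Q" "y \<in> carrier Q"
  shows "rdiv Q x y \<in> carrier Q" "rdiv Q x y \<otimes> y = x"
  using theI'[OF right_division[OF assms]] by (simp_all add: rdiv_def)

lemma (in middle_bol_loop) inv_eq:
  assumes x: "x \<in> carrier Q"
  shows "inv x = ldiv Q x \<one>" "inv x = rdiv Q \<one> x"
proof -
  note one = one_closed
  have one_div: "ldiv Q \<one> \<one> = \<one>"
    using ldiv_props[OF one one] left_one by simp
  have "\<one> \<otimes> ldiv Q (\<one> \<otimes> x) \<one> = rdiv Q \<one> x \<otimes> ldiv Q \<one> \<one>"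
    using middle_bol[OF one one x] .
  then have eq: "ldiv Q x \<one> = rdiv Q \<one> x"
    using x one one_div ldiv_props(1)[OF x one] rdiv_props(1)[OF one x]
    by (simp add: left_one right_one)
  show "inv x = ldiv Q x \<one>"
    unfolding m_inv_def
  proof (rule the_equality)
    show "ldiv Q x \<one> \<in> carrier Q \<and> x \<otimes> ldiv Q x \<one> = \<one> \<and> ldiv Q x \<one> \<otimes> x = \<one>"
      using ldiv_props[OF x one] rdiv_props[OF one x] eq by simp
  next
    fix y assume "y \<in> carrier Q \<and> x \<otimes> y = \<one> \<and> y \<otimes> x = \<one>"
    then show "y = ldiv Q x \<one>"
      using left_division[OF x one] ldiv_props[OF x one] by blast
  qed
  then show "inv x = rdiv Q \<one> x" by (simp add: eq)
qed

definition opposite :: "('a \<Rightarrow> 'a \<Rightarrow> 'a) \<Rightarrow> 'a \<Rightarrow> 'a \<Rightarrow> 'a" where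
  "opposite op x y = op y x"

definition coincide_on :: "'a set \<Rightarrow> ('a \<Rightarrow> 'a \<Rightarrow> 'a) \<Rightarrow> ('a \<Rightarrow> 'a \<Rightarrow> 'a) \<Rightarrow> bool" where
  "coincide_on A op1 op2 \<longleftrightarrow> (\<forall>x\<in>A. \<forall>y\<in>A. op1 x y = op2 x y)"

definition commutative :: "('a, 'b) monoid_scheme \<Rightarrow> bool" where
  "commutative Q \<longleftrightarrow> (\<forall>x\<in>carrier Q. \<forall>y\<in>carrier Q. x \<otimes>\<^bsub>Q\<^esub> y = y \<otimes>\<^bsub>Q\<^esub> x)"

end

theory Submission
  imports Defs
begin

text \<open>The middle Bol identity says $x((yz)\backslash x) = (x/z)(y\backslash x)$. Whenever one factor
  on the right is $x/x$ or $x\backslash x$, the right side is a single quotient: $z = x$ turns it into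
  $x((yx)\backslash x) = y\backslash x$, and $y = x$ (with $z$ renamed to $y$) into
  $x((xy)\backslash x) = x/y$. These are the two descriptions of \<open>f1\<close> and of \<open>g1\<close>.

  Both descriptions are injective in the part that distinguishes \<open>f1\<close> from \<open>g1\<close>: $a\backslash x$
  determines $a$, and $x\backslash b$ determines $b$. Hence, for each single pair $(x,y)$, the
  equality of \<open>f1\<close> and \<open>g1\<close> at $(x,y)$ means $yx = xy$ by the first descriptions and
  $y\backslash x = x/y$ by the second ones. The equivalences about commutativity and about
  coinciding divisions hold therefore pointwise, before quantification. The last
  equivalence also concerns $y\backslash x = x/y$: both sides are ways of saying that one
  quotient solves the equation of the other. The special values all lie at pairs of
  commuting elements, which is why the lists for \<open>f1\<close> and \<open>g1\<close> are the same.\<close>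

lemma (in loop) ldiv_eqI:
  assumes "x \<in> carrier Q" "z \<in> carrier Q" "x \<otimes> z = y"
  shows "ldiv Q x y = z"
  using assms left_division[of x y] ldiv_props[of x y] mult_closed by blast

lemma (in loop) rdiv_eqI:
  assumes "y \<in> carrier Q" "z \<in> carrier Q" "z \<otimes> y = x"
  shows "rdiv Q x y = z"
  using assms right_division[of x y] rdiv_props[of x y] mult_closed by blast

lemma (in loop) ldiv_self:
  "x \<in> carrier Q \<Longrightarrow> ldiv Q x x = \<one>"
  by (simp add: ldiv_eqI one_closed right_one)

lemma (in loop) rdiv_self:
  "x \<in> carrier Q \<Longrightarrow> rdiv Q x x = \<one>"
  by (simp add: rdiv_eqI one_closed left_one)

lemma (in loop) ldiv_left_cancel:
  assumes "x \<in> carrier Q" "a \<in> carrier Q" "b \<in> carrier Q"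
  shows "ldiv Q x a = ldiv Q x b \<longleftrightarrow> a = b"
  using ldiv_props(2)[of x] assms by metis

text \<open>If $a\backslash x = b\backslash x = z$, then $az = x = bz$, and a right factor can be cancelled.\<close>

lemma (in loop) ldiv_right_cancel:
  assumes "a \<in> carrier Q" "b \<in> carrier Q" "x \<in> carrier Q"
  shows "ldiv Q a x = ldiv Q b x \<longleftrightarrow> a = b"
  using ldiv_props[of a x] ldiv_props[of b x] rdiv_eqI assms by metis

text \<open>Quotients are unique solutions: $y\backslash x$ of $yz = x$ and $x/y$ of $zy = x$. So as soon
  as one of them solves the equation of the other, the two are equal.\<close>

lemma (in loop) ldiv_eq_rdiv_iff:
  assumes x: "x \<in> carrier Q" and y: "y \<in> carrier Q"
  shows "ldiv Q y x = rdiv Q x y \<longleftrightarrow> y \<otimes> rdiv Q x y = x"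
    and "ldiv Q y x = rdiv Q x y \<longleftrightarrow> ldiv Q y x \<otimes> y = x"
  using ldiv_props[OF y x] rdiv_props[OF x y] ldiv_eqI[OF y] rdiv_eqI[OF y] by metis+

lemma (in middle_bol_loop) inv_props:
  assumes "x \<in> carrier Q"
  shows "inv x \<in> carrier Q" "x \<otimes> inv x = \<one>" "inv x \<otimes> x = \<one>"
  using assms ldiv_props[OF assms one_closed] rdiv_props[OF one_closed assms]
  by (simp_all flip: inv_eq)

lemma (in middle_bol_loop) inv_one_loop:
  "inv \<one> = \<one>"
  by (simp add: inv_eq(1) ldiv_self one_closed)

lemma (in middle_bol_loop) inv_inv_loop:
  "x \<in> carrier Q \<Longrightarrow> inv (inv x) = x"
  by (simp add: inv_eq(1)[of "inv x"] inv_props ldiv_eqI)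

lemma (in middle_bol_loop) ldiv_mult_self_right:
  assumes x: "x \<in> carrier Q" and y: "y \<in> carrier Q"
  shows "ldiv Q (y \<otimes> x) x = ldiv Q x (ldiv Q y x)"
proof -
  have "x \<otimes> ldiv Q (y \<otimes> x) x = ldiv Q y x"
    using middle_bol[OF x y x] x ldiv_props(1)[OF y x] by (simp add: rdiv_self left_one)
  then show ?thesis
    using ldiv_eqI[OF x] ldiv_props(1)[OF mult_closed[OF y x] x] by simp
qed

lemma (in middle_bol_loop) ldiv_mult_self_left:
  assumes x: "x \<in> carrier Q" and y: "y \<in> carrier Q"
  shows "ldiv Q (x \<otimes> y) x = ldiv Q x (rdiv Q x y)"
proof -
  have "x \<otimes> ldiv Q (x \<otimes> y) x = rdiv Q x y"
    using middle_bol[OF x x y] x rdiv_props(1)[OF x y] by (simp add: ldiv_self right_one)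
  then show ?thesis
    using ldiv_eqI[OF x] ldiv_props(1)[OF mult_closed[OF x y] x] by simp
qed

text \<open>Two ways of cancelling in the same equation: the products can be compared under
  $\cdot\,\backslash x$, and the quotients under $x\backslash\,\cdot$, because the middle Bol identity gives
  both sides a second form.\<close>

lemma (in middle_bol_loop) ldiv_mult_self_eq_iff:
  assumes x: "x \<in> carrier Q" and y: "y \<in> carrier Q"
  shows "ldiv Q (y \<otimes> x) x = ldiv Q (x \<otimes> y) x \<longleftrightarrow> y \<otimes> x = x \<otimes> y"
    and "ldiv Q (y \<otimes> x) x = ldiv Q (x \<otimes> y) x \<longleftrightarrow> ldiv Q y x = rdiv Q x y"
proof -
  show "ldiv Q (y \<otimes> x) x = ldiv Q (x \<otimes> y) x \<longleftrightarrow> y \<otimes> x = x \<otimes> y"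
    using x y by (simp add: ldiv_right_cancel mult_closed)
  show "ldiv Q (y \<otimes> x) x = ldiv Q (x \<otimes> y) x \<longleftrightarrow> ldiv Q y x = rdiv Q x y"
    unfolding ldiv_mult_self_right[OF x y] ldiv_mult_self_left[OF x y]
    using ldiv_left_cancel[OF x ldiv_props(1)[OF y x] rdiv_props(1)[OF x y]] .
qed

text \<open>All products here except $xx$ collapse to a single element because a factor is \<open>\<one>\<close> or the
  factors are inverse to each other. For $xx$, the middle Bol identity gives
  $(xx)\backslash x = x\backslash(x\backslash x) = x\backslash e$. Each value is listed for both orders
  of its factors, one for \<open>f1\<close> and one for \<open>g1\<close>.\<close>

lemma (in middle_bol_loop) ldiv_mult_self_values:
  assumes x: "x \<in> carrier Q"
  shows "ldiv Q (\<one> \<otimes> x) x = \<one>" "ldiv Q (x \<otimes> \<one>) x = \<one>"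
    and "ldiv Q (x \<otimes> \<one>) \<one> = inv x" "ldiv Q (\<one> \<otimes> x) \<one> = inv x"
    and "ldiv Q (x \<otimes> x) x = inv x"
    and "ldiv Q (x \<otimes> inv x) (inv x) = inv x" "ldiv Q (inv x \<otimes> x) (inv x) = inv x"
    and "ldiv Q (inv x \<otimes> \<one>) \<one> = x" "ldiv Q (\<one> \<otimes> inv x) \<one> = x"
    and "ldiv Q (inv x \<otimes> x) x = x" "ldiv Q (x \<otimes> inv x) x = x"
  using x one_closed inv_props[OF x] ldiv_mult_self_right[OF x x]
  by (simp_all add: left_one right_one ldiv_self ldiv_eqI)

theorem lemma2p2:
  fixes Q :: "('a, 'b) monoid_scheme" (structure)
    and f1 g1 :: "'a \<times> 'a \<Rightarrow> 'a"
  assumes "middle_bol_loop Q"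
    and "f1 \<in> carrier Q \<times> carrier Q \<rightarrow> carrier Q"
    and "g1 \<in> carrier Q \<times> carrier Q \<rightarrow> carrier Q"
  shows
    "((\<forall>x\<in>carrier Q. \<forall>y\<in>carrier Q. f1 (x, y) = ldiv Q (y \<otimes> x) x) \<longleftrightarrow>
      (\<forall>x\<in>carrier Q. \<forall>y\<in>carrier Q. f1 (x, y) = ldiv Q x (ldiv Q y x))) \<and>
     ((\<forall>x\<in>carrier Q. \<forall>y\<in>carrier Q. f1 (x, y) = ldiv Q (y \<otimes> x) x) \<longrightarrow>
      (\<forall>x\<in>carrier Q.
         f1 (x, \<one>) = \<one> \<and>
         f1 (inv x, \<one>) = \<one> \<and>
         f1 (\<one>, \<one>) = \<one> \<and>
         f1 (\<one>, x) = inv x \<and>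
         f1 (x, x) = inv x \<and>
         f1 (inv x, x) = inv x \<and>
         f1 (\<one>, inv x) = x \<and>
         f1 (x, inv x) = x)) \<and>
     ((\<forall>x\<in>carrier Q. \<forall>y\<in>carrier Q. g1 (x, y) = ldiv Q (x \<otimes> y) x) \<longleftrightarrow>
      (\<forall>x\<in>carrier Q. \<forall>y\<in>carrier Q. g1 (x, y) = ldiv Q x (rdiv Q x y))) \<and>
     ((\<forall>x\<in>carrier Q. \<forall>y\<in>carrier Q. g1 (x, y) = ldiv Q (x \<otimes> y) x) \<longrightarrow>
      (\<forall>x\<in>carrier Q.
         g1 (x, \<one>) = \<one> \<and>
         g1 (inv x, \<one>) = \<one> \<and>
         g1 (\<one>, \<one>) = \<one> \<and>
         g1 (\<one>, x) = inv x \<and>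
         g1 (x, x) = inv x \<and>
         g1 (inv x, x) = inv x \<and>
         g1 (\<one>, inv x) = x \<and>
         g1 (x, inv x) = x)) \<and>
     ((\<forall>x\<in>carrier Q. \<forall>y\<in>carrier Q. f1 (x, y) = ldiv Q (y \<otimes> x) x) \<and>
      (\<forall>x\<in>carrier Q. \<forall>y\<in>carrier Q. g1 (x, y) = ldiv Q (x \<otimes> y) x) \<longrightarrow>
        ((\<forall>x\<in>carrier Q. \<forall>y\<in>carrier Q. f1 (x, y) = g1 (x, y)) \<longleftrightarrow> commutative Q) \<and>
        ((\<forall>x\<in>carrier Q. \<forall>y\<in>carrier Q. f1 (x, y) = g1 (x, y)) \<longleftrightarrow>
           coincide_on (carrier Q) (opposite (ldiv Q)) (rdiv Q)) \<and>
        (coincide_on (carrier Q) (opposite (ldiv Q)) (rdiv Q) \<longleftrightarrow>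
           coincide_on (carrier Q) (ldiv Q) (opposite (rdiv Q))) \<and>
        ((\<forall>x\<in>carrier Q. \<forall>y\<in>carrier Q. f1 (x, y) = g1 (x, y)) \<longleftrightarrow>
           (\<forall>x\<in>carrier Q. \<forall>y\<in>carrier Q. ldiv Q (y \<otimes> x) x = ldiv Q x (rdiv Q x y))) \<and>
        ((\<forall>x\<in>carrier Q. \<forall>y\<in>carrier Q. ldiv Q (y \<otimes> x) x = ldiv Q x (rdiv Q x y)) \<longleftrightarrow>
           (\<forall>x\<in>carrier Q. \<forall>y\<in>carrier Q. ldiv Q (x \<otimes> y) x = ldiv Q x (ldiv Q y x)))) \<and>
     ((\<forall>x\<in>carrier Q. \<forall>y\<in>carrier Q. x = y \<otimes> rdiv Q x y) \<longleftrightarrow>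
      (\<forall>x\<in>carrier Q. \<forall>y\<in>carrier Q. ldiv Q y x \<otimes> y = x))"
proof -
  interpret middle_bol_loop Q by fact
  let ?C = "carrier Q"
  let ?F = "\<forall>x\<in>?C. \<forall>y\<in>?C. f1 (x, y) = ldiv Q (y \<otimes> x) x"
  let ?G = "\<forall>x\<in>?C. \<forall>y\<in>?C. g1 (x, y) = ldiv Q (x \<otimes> y) x"
  let ?E = "\<forall>x\<in>?C. \<forall>y\<in>?C. f1 (x, y) = g1 (x, y)"
  let ?D = "\<forall>x\<in>?C. \<forall>y\<in>?C. ldiv Q y x = rdiv Q x y"

  have f_forms: "?F \<longleftrightarrow> (\<forall>x\<in>?C. \<forall>y\<in>?C. f1 (x, y) = ldiv Q x (ldiv Q y x))"
    by (simp add: ldiv_mult_self_right)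
  have g_forms: "?G \<longleftrightarrow> (\<forall>x\<in>?C. \<forall>y\<in>?C. g1 (x, y) = ldiv Q x (rdiv Q x y))"
    by (simp add: ldiv_mult_self_left)

  have f_values: "?F \<longrightarrow> (\<forall>x\<in>?C.
      f1 (x, \<one>) = \<one> \<and> f1 (inv x, \<one>) = \<one> \<and> f1 (\<one>, \<one>) = \<one> \<and>
      f1 (\<one>, x) = inv x \<and> f1 (x, x) = inv x \<and> f1 (inv x, x) = inv x \<and>
      f1 (\<one>, inv x) = x \<and> f1 (x, inv x) = x)"
    by (simp add: one_closed inv_props(1) inv_one_loop inv_inv_loop ldiv_mult_self_values)
  have g_values: "?G \<longrightarrow> (\<forall>x\<in>?C.
      g1 (x, \<one>) = \<one> \<and> g1 (inv x, \<one>) = \<one> \<and> g1 (\<one>, \<one>) = \<one> \<and>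
      g1 (\<one>, x) = inv x \<and> g1 (x, x) = inv x \<and> g1 (inv x, x) = inv x \<and>
      g1 (\<one>, inv x) = x \<and> g1 (x, inv x) = x)"
    by (simp add: one_closed inv_props(1) inv_one_loop inv_inv_loop ldiv_mult_self_values)

  have opp1: "coincide_on ?C (opposite (ldiv Q)) (rdiv Q) \<longleftrightarrow> ?D"
    by (simp add: coincide_on_def opposite_def)
  have opp2: "coincide_on ?C (ldiv Q) (opposite (rdiv Q)) \<longleftrightarrow> ?D"
    unfolding coincide_on_def opposite_def by blast

  have eq_comm: "?E \<longleftrightarrow> commutative Q" if ?F ?G
    using that by (auto simp: commutative_def ldiv_mult_self_eq_iff(1))
  have eq_div: "?E \<longleftrightarrow> ?D" if ?F ?G
    using that by (simp add: ldiv_mult_self_eq_iff(2))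
  \<comment> \<open>Each mixed equation is an equality of \<open>f1\<close> and \<open>g1\<close> with one side in its other form.\<close>
  have mixed1: "(\<forall>x\<in>?C. \<forall>y\<in>?C. ldiv Q (y \<otimes> x) x = ldiv Q x (rdiv Q x y)) \<longleftrightarrow> ?D"
    using ldiv_mult_self_eq_iff(2) ldiv_mult_self_left by metis
  have mixed2: "(\<forall>x\<in>?C. \<forall>y\<in>?C. ldiv Q (x \<otimes> y) x = ldiv Q x (ldiv Q y x)) \<longleftrightarrow> ?D"
    using ldiv_mult_self_eq_iff(2) ldiv_mult_self_right by metis

  have swap: "(\<forall>x\<in>?C. \<forall>y\<in>?C. x = y \<otimes> rdiv Q x y) \<longleftrightarrow>
      (\<forall>x\<in>?C. \<forall>y\<in>?C. ldiv Q y x \<otimes> y = x)"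
    using ldiv_eq_rdiv_iff by metis

  \<comment> \<open>Every condition on quotients is now \<open>?D\<close>, so some of the equivalences become trivial.\<close>
  have equivalences: "?F \<and> ?G \<longrightarrow>
      (?E \<longleftrightarrow> commutative Q) \<and> (?E \<longleftrightarrow> ?D) \<and> (?D \<longleftrightarrow> ?D) \<and> (?E \<longleftrightarrow> ?D) \<and> (?D \<longleftrightarrow> ?D)"
    using eq_comm eq_div by blast
  show ?thesis
    unfolding opp1 opp2 mixed1 mixed2
    by (intro conjI f_forms f_values g_forms g_values equivalences swap)
qed

end
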